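(* Let $r,s$ be nonnegative integers and let $(A_n)_{n\ge1}$ be a sequence in $\mathbb{R}^{d_1\times d_2\times d_3}$ with $A_n\to A$, where $\operatorname{rank}_\otimes(A)=r+s$ and $\operatorname{rank}_\otimes(A_n)\le r$ for all $n$. If we write $$A_n=\lambda_{1,n}\,\mathbf{u}_{1,n}\otimes\mathbf{v}_{1,n}\otimes\mathbf{w}_{1,n}+\dots+\lambda_{r,n}\,\mathbf{u}_{r,n}\otimes\mathbf{v}_{r,n}\otimes\mathbf{w}_{r,n},$$ where $\lambda_{i,n}\in\mathbb{R}$ and the vectors $\mathbf{u}_{i,n},\mathbf{v}_{i,n},\mathbf{w}_{i,n}$ are unit vectors, then there are two possibilities: either (i) all of the sequences $|\lambda_{i,n}|$, $i=1,\dots,r$, diverge to $\infty$ as $n\to\infty$; or (ii) in the same tensor space $\mathbb{R}^{d_1\times d_2\times d_3}$ there exists a convergent sequence $B_n\to B$ with $\operatorname{rank}_\otimes(B)\ge r'+s$ and $\operatorname{rank}_\otimes(B_n)\le r'$ for all $n$, for some $r'<r$.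
   Context: $\mathbb{R}^{d_1\times d_2\times d_3}\cong\mathbb{R}^{d_1}\otimes\mathbb{R}^{d_2}\otimes\mathbb{R}^{d_3}$ is the space of real 3-way arrays; $\mathbf{x}\otimes\mathbf{y}\otimes\mathbf{z}$ is the array with entries $x_iy_jz_k$ (a decomposable tensor). The outer-product rank $\operatorname{rank}_{\otimes}(A)$ is the least $r\ge 0$ such that $A$ is a sum of $r$ decomposable tensors. Convergence is in the (unique) norm topology; unit vectors are with respect to the Euclidean norm; $r'$ is a nonnegative integer. *)

theory Defs
  imports "HOL-Analysis.Analysis"
begin

text \<open>
  A 3-way array is an element of \<open>real ^ 'd3 ^ 'd2 ^ 'd1\<close>, with entries \<open>A $ i $ j $ k\<close>.  The
  library's norm on this type is the Euclidean norm of the array of entries.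
\<close>

type_synonym ('d1, 'd2, 'd3) tensor3 = "real ^ 'd3 ^ 'd2 ^ 'd1"

definition outer3 :: "real ^ 'd1::finite \<Rightarrow> real ^ 'd2::finite \<Rightarrow> real ^ 'd3::finite \<Rightarrow> ('d1, 'd2, 'd3) tensor3"
  where "outer3 x y z = (\<chi> i j k. x $ i * y $ j * z $ k)"

definition decomposable :: "('d1::finite, 'd2::finite, 'd3::finite) tensor3 \<Rightarrow> bool"
  where "decomposable T \<longleftrightarrow> (\<exists>x y z. T = outer3 x y z)"

definition sum_of_decomposables :: "nat \<Rightarrow> ('d1::finite, 'd2::finite, 'd3::finite) tensor3 \<Rightarrow> bool"
  where "sum_of_decomposables r A \<longleftrightarrow>
    (\<exists>T. (\<forall>i\<in>{1..r}. decomposable (T i)) \<and> A = (\<Sum>i=1..r. T i))"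

definition tensor_rank :: "('d1::finite, 'd2::finite, 'd3::finite) tensor3 \<Rightarrow> nat"
  where "tensor_rank A = (LEAST r. sum_of_decomposables r A)"

text \<open>The set over which the minimum is taken is never empty.\<close>

lemma sum_of_decomposables_exists:
  fixes A :: "('d1::finite, 'd2::finite, 'd3::finite) tensor3"
  shows "\<exists>r. sum_of_decomposables r A"
proof -
  let ?I = "UNIV :: ('d1 \<times> 'd2) set"
  let ?g = "\<lambda>p. outer3 (axis (fst p) 1) (axis (snd p) 1) (A $ fst p $ snd p)"
  have A: "A = (\<Sum>p\<in>?I. ?g p)"
  proof -
    have "A $ i $ j $ k = (\<Sum>p\<in>?I. ?g p) $ i $ j $ k" for i j k
    proof -
      have "(\<Sum>p\<in>?I. ?g p) $ i $ j $ k
          = (\<Sum>p\<in>?I. if p = (i, j) then A $ i $ j $ k else 0)"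
        unfolding sum_component
        by (rule sum.cong) (auto simp: outer3_def axis_def)
      then show ?thesis by simp
    qed
    then show ?thesis by (simp add: vec_eq_iff)
  qed
  obtain h where h: "bij_betw h {1..card ?I} ?I"
    using ex_bij_betw_nat_finite_1[of ?I] by auto
  have "A = (\<Sum>i=1..card ?I. ?g (h i))"
    using A sum.reindex_bij_betw[OF h, of ?g] by simp
  then have "sum_of_decomposables (card ?I) A"
    unfolding sum_of_decomposables_def decomposable_def
    by (intro exI[of _ "\<lambda>i. ?g (h i)"]) blast
  then show ?thesis ..
qed

end

theory Submission
  imports Defs
begin

text \<open>
  If some coefficient sequence does not diverge, its absolute value is bounded along a subsequence,
  so by compactness the corresponding rank-one summand converges, along a further subsequence, to
  a decomposable tensor \<open>t\<close>.  Removing this summand from the approximants lowers the bound on their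
  rank by one, while \<open>L - t\<close> has rank at least \<open>r + s - 1\<close>.
\<close>

lemma scaleR_outer3: "c *\<^sub>R outer3 x y z = outer3 (c *\<^sub>R x) y z"
  by (simp add: outer3_def vec_eq_iff)

lemma tendsto_outer3:
  assumes "(x \<longlongrightarrow> a) F" "(y \<longlongrightarrow> b) F" "(z \<longlongrightarrow> c) F"
  shows "((\<lambda>n. outer3 (x n) (y n) (z n)) \<longlongrightarrow> outer3 a b c) F"
  unfolding outer3_def by (intro tendsto_intros assms)

lemma tensor_rank_le: "sum_of_decomposables k A \<Longrightarrow> tensor_rank A \<le> k"
  unfolding tensor_rank_def by (rule Least_le)

lemma sum_of_decomposables_tensor_rank: "sum_of_decomposables (tensor_rank A) A"
  unfolding tensor_rank_def using sum_of_decomposables_exists by (rule LeastI_ex)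

text \<open>Reindexing along a bijection with \<open>{1..card I}\<close> allows any finite index
  set, such as \<open>{1..r}\<close> with one index deleted.\<close>

lemma sum_of_decomposables_sum:
  assumes "finite I" "\<And>i. i \<in> I \<Longrightarrow> decomposable (T i)"
  shows "sum_of_decomposables (card I) (\<Sum>i\<in>I. T i)"
proof -
  obtain h where h: "bij_betw h {1..card I} I"
    using ex_bij_betw_nat_finite_1[OF \<open>finite I\<close>] by auto
  have "(\<Sum>i\<in>I. T i) = (\<Sum>k=1..card I. T (h k))"
    using sum.reindex_bij_betw[OF h, of T] by simp
  moreover have "decomposable (T (h k))" if "k \<in> {1..card I}" for k
    using assms(2) bij_betwE[OF h] that by blast
  ultimately show ?thesis
    unfolding sum_of_decomposables_def by (intro exI[of _ "T \<circ> h"]) simp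
qed

text \<open>Appending \<open>t\<close> as one extra term to a shortest decomposition of
  \<open>A - t\<close> gives a decomposition of \<open>A\<close>. Read backwards, this bounds from
  below the rank that is left after subtracting \<open>t\<close>.\<close>

lemma tensor_rank_le_Suc_diff:
  assumes "decomposable t"
  shows "tensor_rank A \<le> Suc (tensor_rank (A - t))"
proof (rule tensor_rank_le)
  obtain T where T: "\<And>i. i \<in> {1..tensor_rank (A - t)} \<Longrightarrow> decomposable (T i)"
      and sum: "A - t = (\<Sum>i=1..tensor_rank (A - t). T i)"
    using sum_of_decomposables_tensor_rank[of "A - t"]
    unfolding sum_of_decomposables_def by blast
  let ?T = "T(Suc (tensor_rank (A - t)) := t)"
  have "A = (\<Sum>i=1..tensor_rank (A - t). T i) + t"
    using sum by (metis diff_add_cancel)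
  also have "\<dots> = (\<Sum>i=1..Suc (tensor_rank (A - t)). ?T i)"
    by simp
  finally show "sum_of_decomposables (Suc (tensor_rank (A - t))) A"
    unfolding sum_of_decomposables_def using T assms
    by (intro exI[of _ ?T]) (auto simp: le_Suc_eq)
qed

text \<open>Failure of divergence yields a \<open>K\<close> that \<open>f\<close> fails to exceed
  infinitely often; enumerating those indices in increasing order gives the subsequence.\<close>

lemma not_filterlim_at_top_bounded_subseq:
  fixes f :: "nat \<Rightarrow> 'a::linorder"
  assumes "\<not> filterlim f at_top sequentially"
  obtains \<phi> :: "nat \<Rightarrow> nat" and K where "strict_mono \<phi>" "\<And>n. f (\<phi> n) \<le> K"
proof -
  obtain K where "\<not> (\<forall>\<^sub>F n in sequentially. K \<le> f n)"
    using assms unfolding filterlim_at_top by blast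
  then have "\<exists>\<^sub>F n in sequentially. f n \<le> K"
    unfolding frequently_def
    by (rule contrapos_nn) (auto elim!: eventually_mono)
  then have inf: "infinite {n. f n \<le> K}"
    using frequently_cofinite[of "\<lambda>n. f n \<le> K"] by (simp add: cofinite_eq_sequentially)
  show thesis
  proof
    show "strict_mono (enumerate {n. f n \<le> K})"
      using inf by (rule strict_mono_enumerate)
    show "f (enumerate {n. f n \<le> K} n) \<le> K" for n
      using enumerate_in_set[OF inf, of n] by simp
  qed
qed

text \<open>Compactness is applied to the factors rather than to the tensors: the limit is then
  visibly an outer product, by continuity of \<open>outer3\<close>.\<close>

lemma outer3_convergent_subseq:
  fixes x :: "nat \<Rightarrow> real ^ 'd1::finite" and y :: "nat \<Rightarrow> real ^ 'd2::finite"
    and z :: "nat \<Rightarrow> real ^ 'd3::finite"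
  assumes "bounded (range x)" "bounded (range y)" "bounded (range z)"
  obtains \<phi> :: "nat \<Rightarrow> nat" and t
  where "strict_mono \<phi>" "decomposable t"
    "(\<lambda>n. outer3 (x (\<phi> n)) (y (\<phi> n)) (z (\<phi> n))) \<longlonglongrightarrow> t"
proof -
  \<comment> \<open>Bundling the factors into one sequence of triples provides a single subsequence
    along which all three converge.\<close>
  let ?X = "\<lambda>n. (x n, y n, z n)"
  have "bounded (range ?X)"
    by (rule bounded_subset[of "range x \<times> range y \<times> range z"])
      (auto intro!: bounded_Times assms)
  then obtain l \<phi> where \<phi>: "strict_mono (\<phi> :: nat \<Rightarrow> nat)" and lim: "(?X \<circ> \<phi>) \<longlonglongrightarrow> l"
    using bounded_imp_convergent_subsequence by blast
  have "(\<lambda>n. x (\<phi> n)) \<longlonglongrightarrow> fst l" "(\<lambda>n. y (\<phi> n)) \<longlonglongrightarrow> fst (snd l)"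
      "(\<lambda>n. z (\<phi> n)) \<longlonglongrightarrow> snd (snd l)"
    using tendsto_fst[OF lim] tendsto_fst[OF tendsto_snd[OF lim]]
      tendsto_snd[OF tendsto_snd[OF lim]] by (simp_all add: o_def)
  from tendsto_outer3[OF this] show thesis
    using that[OF \<phi>] unfolding decomposable_def by blast
qed

theorem proposition4p9:
  fixes r s :: nat
    and A :: "nat \<Rightarrow> ('d1::finite, 'd2::finite, 'd3::finite) tensor3"
    and L :: "('d1, 'd2, 'd3) tensor3"
    and lam :: "nat \<Rightarrow> nat \<Rightarrow> real"
    and u :: "nat \<Rightarrow> nat \<Rightarrow> real ^ 'd1"
    and v :: "nat \<Rightarrow> nat \<Rightarrow> real ^ 'd2"
    and w :: "nat \<Rightarrow> nat \<Rightarrow> real ^ 'd3"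
  assumes "A \<longlonglongrightarrow> L"
    and "tensor_rank L = r + s"
    and "\<And>n. tensor_rank (A n) \<le> r"
    and "\<And>i n. i \<in> {1..r} \<Longrightarrow> norm (u i n) = 1"
    and "\<And>i n. i \<in> {1..r} \<Longrightarrow> norm (v i n) = 1"
    and "\<And>i n. i \<in> {1..r} \<Longrightarrow> norm (w i n) = 1"
    and "\<And>n. A n = (\<Sum>i=1..r. lam i n *\<^sub>R outer3 (u i n) (v i n) (w i n))"
  shows "(\<forall>i\<in>{1..r}. filterlim (\<lambda>n. \<bar>lam i n\<bar>) at_top sequentially) \<or>
    (\<exists>r'<r. \<exists>(B :: nat \<Rightarrow> ('d1, 'd2, 'd3) tensor3) M.
       B \<longlonglongrightarrow> M \<and> tensor_rank M \<ge> r' + s \<and> (\<forall>n. tensor_rank (B n) \<le> r'))"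
proof (unfold disj_imp, rule impI)
  assume "\<not> (\<forall>i\<in>{1..r}. filterlim (\<lambda>n. \<bar>lam i n\<bar>) at_top sequentially)"
  then obtain i where i: "i \<in> {1..r}"
      and "\<not> filterlim (\<lambda>n. \<bar>lam i n\<bar>) at_top sequentially"
    by blast
  then obtain \<phi> :: "nat \<Rightarrow> nat" and K where \<phi>: "strict_mono \<phi>" and K: "\<And>n. \<bar>lam i (\<phi> n)\<bar> \<le> K"
    using not_filterlim_at_top_bounded_subseq by blast
  \<comment> \<open>The coefficient is absorbed into the first factor, whose norm is then
    \<open>\<bar>lam j n\<bar>\<close>. For \<open>j = i\<close> it is at most \<open>K\<close>
    along \<open>\<phi>\<close>, while the other two factors stay unit vectors.\<close>
  define T where "T = (\<lambda>j n. outer3 (lam j n *\<^sub>R u j n) (v j n) (w j n))"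
  have "bounded (range (\<lambda>n. lam i (\<phi> n) *\<^sub>R u i (\<phi> n)))"
      "bounded (range (\<lambda>n. v i (\<phi> n)))" "bounded (range (\<lambda>n. w i (\<phi> n)))"
    by (rule boundedI[of _ K], use K i assms(4) in auto)
      (rule boundedI[of _ 1], use i assms(5,6) in auto)+
  then obtain \<psi> t where \<psi>: "strict_mono (\<psi> :: nat \<Rightarrow> nat)" and t: "decomposable t"
      and lim_T: "(\<lambda>n. T i (\<phi> (\<psi> n))) \<longlonglongrightarrow> t"
    unfolding T_def by (rule outer3_convergent_subseq)
  define B where "B = (\<lambda>n. A (\<phi> (\<psi> n)) - T i (\<phi> (\<psi> n)))"
  have "(\<lambda>n. A (\<phi> (\<psi> n))) \<longlonglongrightarrow> L"
    using LIMSEQ_subseq_LIMSEQ[OF assms(1) strict_mono_o[OF \<phi> \<psi>]] by (simp add: o_def)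
  then have "B \<longlonglongrightarrow> L - t"
    unfolding B_def using lim_T by (rule tendsto_diff)
  \<comment> \<open>Since \<open>i\<close> lies in \<open>{1..r}\<close>, \<open>r\<close> is
    positive, so the truncated \<open>r - 1\<close> is a true predecessor.\<close>
  moreover have "tensor_rank (L - t) \<ge> r - 1 + s"
    using tensor_rank_le_Suc_diff[OF t, of L] assms(2) i by simp
  moreover have "tensor_rank (B n) \<le> r - 1" for n
  proof -
    \<comment> \<open>The subtracted tensor is itself a term of the given decomposition of
      \<open>A m\<close>, so \<open>r - 1\<close> terms remain.\<close>
    have "A m - T i m = (\<Sum>j\<in>{1..r} - {i}. T j m)" for m
      using i by (simp add: assms(7) scaleR_outer3 T_def sum_diff1)
    moreover have "decomposable (T j m)" for j m
      unfolding T_def decomposable_def by blast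
    ultimately have "sum_of_decomposables (card ({1..r} - {i})) (B n)"
      unfolding B_def by (simp only: sum_of_decomposables_sum finite_Diff finite_atLeastAtMost)
    with i show ?thesis
      by (auto dest: tensor_rank_le)
  qed
  moreover have "r - 1 < r"
    using i by simp
  ultimately show "\<exists>r'<r. \<exists>(B :: nat \<Rightarrow> ('d1, 'd2, 'd3) tensor3) M.
       B \<longlonglongrightarrow> M \<and> tensor_rank M \<ge> r' + s \<and> (\<forall>n. tensor_rank (B n) \<le> r')"
    by (intro exI[of _ "r - 1"] exI[of _ B] exI[of _ "L - t"] conjI allI) blast+
qed

end
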